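(* Let $\mathbb{G}$ be the system $\dot x=Ax+Bw$, $z=Cx$ with $m$ inputs and $m$ outputs described in the context. Suppose $A$ is Hurwitz and let $\theta>0$ be an $m\times m$ diagonal matrix. Then $$\|\theta^{-1}\mathbb{G}\theta\|_{MS}^2=\inf_{\mathcal{P}>0,\ \mathcal{S}>0,\ \gamma}\gamma$$ where the infimum is over symmetric positive definite $\mathcal{P}$ (of the size of $A$), symmetric positive definite $\mathcal{S}\in\mathbb{R}^{m\times m}$ and $\gamma\in\mathbb{R}$ subject to $\mathcal{S}_{\ell\ell}<\gamma$ for $\ell=1,\dots,m$, and $$\begin{bmatrix} A^\top\mathcal{P}+\mathcal{P}A & \mathcal{P}B\theta \\ \theta B^\top\mathcal{P} & -I \end{bmatrix}<0,\qquad\begin{bmatrix} \theta\mathcal{S}\theta & C \\ C^\top & \mathcal{P} \end{bmatrix}>0 .$$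
   Context: Setting. The plant is $\dot x_p=A_px_p+B_pu_p$, $y_p=C_px_p$ with $x_p\in\mathbb{R}^n$, $u_p\in\mathbb{R}^d$, $y_p\in\mathbb{R}^q$, stabilizable, detectable (and strictly proper). The controller is $\dot x_k=A_kx_k+B_ky_k$, $u_k=C_kx_k$ with $x_k\in\mathbb{R}^n$. With $\Lambda_O$ ($q\times q$) and $\Lambda_I$ ($d\times d$) real diagonal matrices (means of the output and input channel uncertainties) and $m=q+d$, the nominal system $\mathbb{G}$ is $\dot x=Ax+Bw$, $z=Cx$ with $x=(x_p^\top,x_k^\top)^\top\in\mathbb{R}^{2n}$, $w,z\in\mathbb{R}^m$, $$A=\begin{bmatrix} A_p & B_p\Lambda_IC_k \\ B_k\Lambda_OC_p & A_k \end{bmatrix},\quad B=\begin{bmatrix} 0 & B_p \\ B_k & 0 \end{bmatrix},\quad C=\begin{bmatrix} C_p & 0 \\ 0 & C_k \end{bmatrix}.$$ The mean square norm of a system with $m$ inputs, $m$ outputs and scalar transfer functions $G_{ij}$ from input $j$ to output $i$ is $\|\mathbb{G}\|_{MS}=\max_{i=1,\dots,m}\sqrt{\sum_{j=1}^m\|G_{ij}\|_2^2}$, with $\|\cdot\|_2$ the standard $\mathcal{H}_2$ norm. $\theta^{-1}\mathbb{G}\theta$ is the system with transfer matrix $\theta^{-1}C(sI-A)^{-1}B\theta$. Matrix inequalities are in the sense of definiteness of symmetric matrices. *)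

theory Defs
  imports "HOL-Analysis.Analysis" "HOL-Library.Extended_Real"
begin

(* Matrices with r rows and c columns have type "real ^ 'c ^ 'r"; index sets of
   block matrices are sum types. *)

definition block_mat ::
  "'a ^ 'c1 ^ 'r1 \<Rightarrow> 'a ^ 'c2 ^ 'r1 \<Rightarrow> 'a ^ 'c1 ^ 'r2 \<Rightarrow> 'a ^ 'c2 ^ 'r2
    \<Rightarrow> 'a ^ ('c1 + 'c2) ^ ('r1 + 'r2)" where
  "block_mat M11 M12 M21 M22 =
    (\<chi> i j. case i of
        Inl a \<Rightarrow> (case j of Inl b \<Rightarrow> M11 $ a $ b | Inr b \<Rightarrow> M12 $ a $ b)
      | Inr a \<Rightarrow> (case j of Inl b \<Rightarrow> M21 $ a $ b | Inr b \<Rightarrow> M22 $ a $ b))"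

definition diagonal :: "real ^ 'n ^ 'n \<Rightarrow> bool" where
  "diagonal M \<longleftrightarrow> (\<forall>i j. i \<noteq> j \<longrightarrow> M $ i $ j = 0)"

definition pos_def :: "real ^ 'n ^ 'n \<Rightarrow> bool" where
  "pos_def M \<longleftrightarrow> transpose M = M \<and> (\<forall>x. x \<noteq> 0 \<longrightarrow> 0 < x \<bullet> (M *v x))"

definition neg_def :: "real ^ 'n ^ 'n \<Rightarrow> bool" where
  "neg_def M \<longleftrightarrow> transpose M = M \<and> (\<forall>x. x \<noteq> 0 \<longrightarrow> x \<bullet> (M *v x) < 0)"

abbreviation cmat :: "real ^ 'c ^ 'r \<Rightarrow> complex ^ 'c ^ 'r" where
  "cmat \<equiv> map_matrix complex_of_real"

definition eigenvalue :: "complex ^ 'n ^ 'n \<Rightarrow> complex \<Rightarrow> bool" where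
  "eigenvalue M l \<longleftrightarrow> (\<exists>v. v \<noteq> 0 \<and> M *v v = l *s v)"

definition hurwitz :: "real ^ 'n ^ 'n \<Rightarrow> bool" where
  "hurwitz A \<longleftrightarrow> (\<forall>l. eigenvalue (cmat A) l \<longrightarrow> Re l < 0)"

definition stabilizable :: "real ^ 'n ^ 'n \<Rightarrow> real ^ 'd ^ 'n \<Rightarrow> bool" where
  "stabilizable A B \<longleftrightarrow> (\<exists>F :: real ^ 'n ^ 'd. hurwitz (A + B ** F))"

definition detectable :: "real ^ 'n ^ 'n \<Rightarrow> real ^ 'n ^ 'q \<Rightarrow> bool" where
  "detectable A C \<longleftrightarrow> (\<exists>L :: real ^ 'q ^ 'n. hurwitz (A + L ** C))"

definition transfer_matrix ::
  "real ^ 'n ^ 'n \<Rightarrow> real ^ 'm ^ 'n \<Rightarrow> real ^ 'n ^ 'p \<Rightarrow> complex \<Rightarrow> complex ^ 'm ^ 'p" where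
  "transfer_matrix A B C s = cmat C ** matrix_inv (mat s - cmat A) ** cmat B"

(* Meaningful for stable strictly proper g, where the integral converges (the value
   would be 0 for a g that is not square-integrable on the imaginary axis). *)
definition h2_norm :: "(complex \<Rightarrow> complex) \<Rightarrow> real" where
  "h2_norm g = sqrt (1 / (2 * pi) * (LINT w|lborel. (norm (g (\<i> * complex_of_real w)))\<^sup>2))"

definition ms_norm :: "(complex \<Rightarrow> complex ^ 'm ^ 'm) \<Rightarrow> real" where
  "ms_norm G = Max (range (\<lambda>i. sqrt (\<Sum>j\<in>UNIV. (h2_norm (\<lambda>s. G s $ i $ j))\<^sup>2)))"

end

theory Submission
  imports Defs "HOL-Complex_Analysis.Cauchy_Integral_Theorem"
begin

text \<open>Write \<open>\<theta>\<^sup>-\<^sup>1 G \<theta>\<close> as the system with input matrix \<open>B \<theta>\<close> and output matrix \<open>\<theta>\<^sup>-\<^sup>1 C\<close>, and let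
  \<open>X\<close> be its controllability Gramian, the solution of \<open>A X + X A\<^sup>T = - (B \<theta>) (B \<theta>)\<^sup>T\<close>. For a real row
  \<open>c\<close> put \<open>u(s) = c (s - A)\<^sup>-\<^sup>1\<close>. On the imaginary axis the Lyapunov equation turns the quadratic form of
  \<open>W = - (A X + X A\<^sup>T)\<close> at \<open>u\<close> into an expression linear in \<open>u\<close>, and Cauchy's theorem on the right half
  plane, where \<open>s u(s) \<rightarrow> c\<close>, gives the principal value \<open>\<pi> c\<close> for the integral of \<open>u\<close>. Thus the integral
  of the form is \<open>2 \<pi> c X c\<^sup>T\<close>. This yields solvability of Lyapunov equations, positivity of their
  solutions, and the row sums of squared \<open>H\<^sub>2\<close> norms.

  With \<open>Q = P\<^sup>-\<^sup>1\<close>, Schur complements turn the two matrix inequalities into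
  \<open>A Q + Q A\<^sup>T + (B \<theta>) (B \<theta>)\<^sup>T < 0\<close> and \<open>S > (\<theta>\<^sup>-\<^sup>1 C) Q (\<theta>\<^sup>-\<^sup>1 C)\<^sup>T\<close>. The first forces \<open>Q \<ge> X\<close>, and
  conversely \<open>Q\<close> may be chosen arbitrarily close to \<open>X\<close>, so the feasible \<open>\<gamma>\<close> are exactly those
  strictly above the squared mean square norm.\<close>

section \<open>Integration along the imaginary axis\<close>

text \<open>Nonnegativity makes the truncations to \<open>[-n, n]\<close> increase to
  \<open>h\<close>, so monotone convergence upgrades a symmetric limit, which is what the contour
  argument gives, to the Lebesgue integral that \<open>h2_norm\<close> uses.\<close>

lemma has_bochner_integral_symmetric_limit:
  fixes h :: "real \<Rightarrow> real"
  assumes cont: "continuous_on UNIV h" and nonneg: "\<And>w. 0 \<le> h w"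
    and lim: "((\<lambda>T. integral {-T..T} h) \<longlongrightarrow> L) at_top"
  shows "integrable lborel h" "integral\<^sup>L lborel h = L"
proof -
  have meas: "h \<in> borel_measurable lborel"
    using borel_measurable_continuous_onI[OF cont] by simp
  have i: "set_integrable lborel {- real n..real n} h" for n
    by (rule borel_integrable_atLeastAtMost') (auto intro: continuous_on_subset[OF cont])
  have eq: "integral\<^sup>L lborel (\<lambda>x. indicator {- real n..real n} x * h x) = integral {- real n..real n} h" for n
    using set_borel_integral_eq_integral(2)[OF i[of n]] by (simp add: set_lebesgue_integral_def)
  have lim': "(\<lambda>n. integral {- real n..real n} h) \<longlonglongrightarrow> L"
    using filterlim_compose[OF lim filterlim_real_sequentially] by simp
  have ev: "(\<lambda>n. indicator {- real n..real n} x * h x) \<longlonglongrightarrow> h x" for x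
  proof (rule tendsto_eventually, rule eventually_sequentiallyI[of "nat \<lceil>\<bar>x\<bar>\<rceil>"])
    fix n assume "nat \<lceil>\<bar>x\<bar>\<rceil> \<le> n"
    then have "\<bar>x\<bar> \<le> real n" by linarith
    then show "indicator {- real n..real n} x * h x = h x"
      by (auto split: split_indicator)
  qed
  have int: "integrable lborel (\<lambda>x. indicator {- real n..real n} x * h x)" for n
    using i[of n] by (simp add: set_integrable_def)
  have mono: "AE x in lborel. mono (\<lambda>n. indicator {- real n..real n} x * h x)"
    using nonneg by (auto intro!: monoI split: split_indicator)
  note R = integral_monotone_convergence_nonneg[OF int mono _ _ _ meas, of L]
  show "integrable lborel h" "integral\<^sup>L lborel h = L"
    by (rule R; use nonneg ev lim' eq in \<open>auto split: split_indicator\<close>)+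
qed

text \<open>A primitive on the half plane turns the integral along the imaginary axis into one along the
  arc of radius \<open>T\<close>, on which \<open>z * f z\<close> is nearly constant.\<close>

lemma half_plane_integral_limit:
  fixes f :: "complex \<Rightarrow> complex"
  assumes cont: "continuous_on {s. 0 \<le> Re s} f"
    and diff: "\<And>s. 0 < Re s \<Longrightarrow> f field_differentiable at s"
    and lim: "((\<lambda>s. s * f s) \<longlongrightarrow> k) (inf at_infinity (principal {s. 0 \<le> Re s}))"
  shows "((\<lambda>T. integral {-T..T} (\<lambda>w. f (\<i> * complex_of_real w))) \<longlongrightarrow> of_real pi * k) at_top"
proof -
  let ?H = "{s::complex. 0 \<le> Re s}"
  have conv: "convex ?H" by (rule convex_halfspace_Re_ge)
  have int: "interior ?H = {s. 0 < Re s}"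
    using interior_halfspace_ge[of "1::complex" 0] by (simp add: inner_complex_def)
  \<comment> \<open>The closed half plane is convex, so continuity up to the axis and holomorphy
    inside yield a primitive that is valid on the axis too.\<close>
  obtain g where g: "\<And>x. x \<in> ?H \<Longrightarrow> (g has_field_derivative f x) (at x within ?H)"
    using holomorphic_convex_primitive[OF conv finite.emptyI cont] diff int by auto
  have line: "((\<lambda>w. f (\<i> * complex_of_real w)) has_integral (g (\<i> * T) - g (- \<i> * T)) / \<i>) {-T..T}"
    if "T > 0" for T :: real
  proof -
    have "((\<lambda>w. f (\<i> * complex_of_real w) * \<i>) has_integral (g (\<i> * T) - g (\<i> * of_real (-T)))) {-T..T}"
    proof (rule fundamental_theorem_of_calculus)
      fix x assume x: "x \<in> {-T..T}"
      have "(g \<circ> (\<lambda>w. \<i> * complex_of_real w) has_vector_derivative \<i> * f (\<i> * complex_of_real x)) (at x within {-T..T})"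
        by (rule field_vector_diff_chain_within[OF _ has_field_derivative_subset[OF g]])
           (auto intro!: derivative_eq_intros has_vector_derivative_of_real)
      then show "((\<lambda>w. g (\<i> * complex_of_real w)) has_vector_derivative f (\<i> * complex_of_real x) * \<i>) (at x within {-T..T})"
        by (simp add: o_def mult.commute)
    qed (use that in simp)
    from has_integral_mult_right[OF this, of "- \<i>"] show ?thesis by (simp add: mult.commute[of _ "\<i>"])
  qed
  \<comment> \<open>The arc has the same end points as the segment, hence gives the same increment
    of \<open>g\<close>.\<close>
  have arc: "((\<lambda>\<phi>. f (of_real T * cis \<phi>) * (\<i> * of_real T * cis \<phi>)) has_integral (g (\<i> * T) - g (- \<i> * T))) {-(pi/2)..pi/2}"
    if "T > 0" for T :: real
  proof -
    have "((\<lambda>\<phi>. f (of_real T * cis \<phi>) * (\<i> * of_real T * cis \<phi>)) has_integral (g (of_real T * cis (pi/2)) - g (of_real T * cis (-(pi/2))))) {-(pi/2)..pi/2}"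
    proof (rule fundamental_theorem_of_calculus)
      fix x assume x: "x \<in> {-(pi/2)..pi/2}"
      have im: "(\<lambda>\<phi>. complex_of_real T * cis \<phi>) ` {-(pi/2)..pi/2} \<subseteq> ?H"
        using that by (auto intro!: mult_nonneg_nonneg cos_ge_zero)
      have "(g \<circ> (\<lambda>\<phi>. of_real T * cis \<phi>) has_vector_derivative (of_real T * (\<i> * cis x)) * f (of_real T * cis x)) (at x within {-(pi/2)..pi/2})"
      proof (rule field_vector_diff_chain_within[OF _ has_field_derivative_subset[OF g im]])
        have "((\<lambda>\<phi>. cis \<phi>) has_vector_derivative \<i> * cis x) (at x within {-(pi/2)..pi/2})"
          unfolding has_vector_derivative_complex_iff
          by (auto intro!: derivative_eq_intros)
        then show "((\<lambda>\<phi>. of_real T * cis \<phi>) has_vector_derivative (of_real T * (\<i> * cis x))) (at x within {-(pi/2)..pi/2})"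
          by (rule has_vector_derivative_mult_right)
      qed (use x im in blast)
      then show "((\<lambda>\<phi>. g (of_real T * cis \<phi>)) has_vector_derivative f (of_real T * cis x) * (\<i> * of_real T * cis x)) (at x within {-(pi/2)..pi/2})"
        by (simp add: o_def mult_ac)
    qed simp
    then show ?thesis by (simp add: mult.commute)
  qed
  show ?thesis
  proof (rule tendstoI)
    fix e :: real assume e: "e > 0"
    \<comment> \<open>The error on the arc is integrated over an angle range of length
      \<open>pi < 4\<close>, hence \<open>e/4\<close>.\<close>
    from tendstoD[OF lim, of "e/4"] e
    have "\<forall>\<^sub>F s in at_infinity. 0 \<le> Re s \<longrightarrow> dist (s * f s) k < e/4"
      by (simp add: eventually_inf_principal)
    then obtain b where b: "\<And>s. b \<le> norm s \<Longrightarrow> 0 \<le> Re s \<Longrightarrow> dist (s * f s) k < e/4"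
      unfolding eventually_at_infinity by blast
    show "\<forall>\<^sub>F T in at_top. dist (integral {-T..T} (\<lambda>w. f (\<i> * complex_of_real w))) (of_real pi * k) < e"
    proof (rule eventually_at_top_linorderI[of "max 1 b"])
      fix T assume "max 1 b \<le> T"
      then have T: "T > 0" "b \<le> T" by auto
      define D where "D = g (\<i> * T) - g (- \<i> * T)"
      have c: "((\<lambda>\<phi>. \<i> * k) has_integral (of_real pi * (\<i> * k))) {-(pi/2)..pi/2}"
        using has_integral_const_real[of "\<i> * k" "-(pi/2)" "pi/2"] by (simp add: scaleR_conv_of_real)
      have "norm (D - of_real pi * (\<i> * k)) \<le> e/4 * measure lborel {-(pi/2)..pi/2}"
      proof (rule has_integral_bound_real[OF _ finite.emptyI has_integral_diff[OF arc[OF T(1), folded D_def] c]])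
        fix \<phi> assume "\<phi> \<in> {-(pi/2)..pi/2} - {}"
        then have \<phi>: "\<phi> \<in> {-(pi/2)..pi/2}" by simp
        let ?z = "of_real T * cis \<phi>"
        have "0 \<le> Re ?z" using T \<phi> by (auto intro!: mult_nonneg_nonneg cos_ge_zero)
        moreover have "b \<le> norm ?z" using T by (simp add: norm_mult)
        ultimately have "norm (?z * f ?z - k) < e/4" using b[of ?z] by (simp add: dist_norm)
        moreover have "f ?z * (\<i> * of_real T * cis \<phi>) - \<i> * k = \<i> * (?z * f ?z - k)"
          by (simp add: algebra_simps)
        ultimately show "norm (f ?z * (\<i> * of_real T * cis \<phi>) - \<i> * k) \<le> e/4"
          by (simp only: norm_mult) simp
      qed (use e in simp)
      also have "\<dots> < e" using e pi_less_4 by simp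
      finally have "norm (D - of_real pi * (\<i> * k)) < e" .
      moreover have "D / \<i> - of_real pi * k = (D - of_real pi * (\<i> * k)) / \<i>"
        by (simp add: field_simps)
      moreover have "integral {-T..T} (\<lambda>w. f (\<i> * complex_of_real w)) = D / \<i>"
        using line[OF T(1)] D_def integral_unique by blast
      ultimately show "dist (integral {-T..T} (\<lambda>w. f (\<i> * complex_of_real w))) (of_real pi * k) < e"
        by (simp only: dist_norm norm_divide norm_ii div_by_1)
    qed
  qed
qed

section \<open>Rows of the resolvent\<close>

abbreviation cvec :: "real ^ 'n \<Rightarrow> complex ^ 'n" where
  "cvec v \<equiv> \<chi> i. complex_of_real (v $ i)"

text \<open>Each row of the transfer matrix is such a row, with \<open>c\<close> a row of
  \<open>C\<close>, multiplied by \<open>B\<close>. So rows are integrated, never the whole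
  resolvent.\<close>

definition resolvent_row :: "real ^ 'n ^ 'n \<Rightarrow> real ^ 'n \<Rightarrow> complex \<Rightarrow> complex ^ 'n" where
  "resolvent_row A c s = cvec c v* matrix_inv (mat s - cmat A)"

lemma matrix_inv_right: "invertible A \<Longrightarrow> A ** matrix_inv A = mat 1"
  and matrix_inv_left: "invertible A \<Longrightarrow> matrix_inv A ** A = mat 1"
  using someI_ex[of "\<lambda>A'. A ** A' = mat 1 \<and> A' ** A = mat 1"]
  unfolding invertible_def matrix_inv_def by blast+

lemma cmat_mult: "cmat (M ** N) = cmat M ** cmat N"
  by (simp add: map_matrix_def matrix_matrix_mult_def vec_eq_iff)

lemma cvec_mult_cmat: "cvec v v* cmat M = cvec (v v* M)"
  by (simp add: vec_eq_iff vector_matrix_mult_def)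

lemma cmat_mult_cvec: "cmat M *v cvec v = cvec (M *v v)"
  by (simp add: vec_eq_iff matrix_vector_mult_def)

text \<open>The inner product of complex vectors is the real one, the real part of the Hermitian
  product. For it the adjoint of a real matrix is its transpose, so no conjugates have to be
  written.\<close>

lemma inner_cmat: "(u v* cmat M) \<bullet> w = u \<bullet> (cmat M *v w)"
proof -
  have "(u v* cmat M) \<bullet> w = (\<Sum>j\<in>UNIV. \<Sum>i\<in>UNIV. M $ i $ j * (u $ i \<bullet> w $ j))"
    by (simp add: inner_vec_def vector_matrix_mult_def inner_sum_left inner_complex_def
        sum.distrib sum_distrib_left sum_distrib_right algebra_simps)
  also have "\<dots> = (\<Sum>i\<in>UNIV. \<Sum>j\<in>UNIV. M $ i $ j * (u $ i \<bullet> w $ j))"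
    by (rule sum.swap)
  also have "\<dots> = u \<bullet> (cmat M *v w)"
    by (simp add: inner_vec_def matrix_vector_mult_def inner_sum_right inner_complex_def
        sum.distrib sum_distrib_left sum_distrib_right algebra_simps)
  finally show ?thesis .
qed

text \<open>A nonzero kernel vector of \<open>s - A\<close> would be an eigenvector for an
  eigenvalue with nonnegative real part.\<close>

lemma hurwitz_invertible:
  fixes A :: "real ^ 'n ^ 'n"
  assumes "hurwitz A" "0 \<le> Re s"
  shows "invertible (mat s - cmat A)"
proof -
  have "inj ((*v) (mat s - cmat A))"
  proof (rule injI)
    fix x y assume eq: "(mat s - cmat A) *v x = (mat s - cmat A) *v y"
    have m: "mat s *v v = s *s v" for v :: "complex ^ 'n"
      by (simp add: vec_eq_iff matrix_vector_mult_def mat_def if_distrib if_distribR cong: if_cong)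
    have "cmat A *v (x - y) = s *s (x - y)"
      using eq m[of x] m[of y] by (simp add: algebra_simps vector_ssub_ldistrib)
    then have "x - y = 0"
      using assms unfolding hurwitz_def eigenvalue_def by (meson not_less)
    then show "x = y" by simp
  qed
  then show ?thesis
    using matrix_left_invertible_injective invertible_left_inverse by blast
qed

lemma resolvent_row_eq:
  assumes "hurwitz A" "0 \<le> Re s"
  shows "resolvent_row A c s v* (mat s - cmat A) = cvec c"
  by (simp add: resolvent_row_def vector_matrix_mul_assoc matrix_inv_left[OF hurwitz_invertible[OF assms]])

lemma resolvent_row_mult_cmat:
  fixes A :: "real ^ 'n ^ 'n"
  assumes "hurwitz A" "0 \<le> Re s"
  shows "resolvent_row A c s v* cmat A = s *s resolvent_row A c s - cvec c"
proof -
  have "v v* mat s = s *s v" for v :: "complex ^ 'n"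
    by (simp add: vec_eq_iff vector_matrix_mult_def mat_def if_distrib if_distribR mult.commute cong: if_cong)
  then show ?thesis using resolvent_row_eq[OF assms, of c] by (simp add: algebra_simps)
qed

text \<open>By Cramer's rule each entry is a quotient of determinants polynomial in
  \<open>s\<close>, with nonvanishing denominator on the closed half plane. Differentiability is
  taken within that half plane, where invertibility is known.\<close>

lemma resolvent_row_differentiable:
  fixes A :: "real ^ 'n ^ 'n"
  assumes A: "hurwitz A" and s: "0 \<le> Re s"
  shows "(\<lambda>s. resolvent_row A c s $ k) field_differentiable at s within {s. 0 \<le> Re s}"
proof -
  \<comment> \<open>The unknown is a row multiplied from the left, so Cramer's rule is applied to
    the transpose; \<open>?N\<close> has \<open>c\<close> as its column \<open>k\<close>.\<close>
  let ?M = "\<lambda>s. transpose (mat s - cmat A)"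
  let ?N = "\<lambda>s. (\<chi> i j. if j = k then cvec c $ i else ?M s $ i $ j) :: complex ^ 'n ^ 'n"
  have d: "det (?M s) \<noteq> 0" if "0 \<le> Re s" for s
    using hurwitz_invertible[OF A that] by (simp add: det_transpose invertible_det_nz)
  have eq: "resolvent_row A c s $ k = det (?N s) / det (?M s)" if "0 \<le> Re s" for s
  proof -
    have "?M s *v resolvent_row A c s = cvec c"
      using resolvent_row_eq[OF A that] by simp
    then have "resolvent_row A c s = (\<chi> k. det(\<chi> i j. if j=k then cvec c $ i else ?M s $i$j) / det (?M s))"
      using cramer[OF d[OF that], of "resolvent_row A c s" "cvec c"] by blast
    then show ?thesis by (metis (no_types, lifting) vec_lambda_beta)
  qed
  have fd: "(\<lambda>s. det (X s)) field_differentiable at s within S"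
    if "\<And>i j. (\<lambda>s. X s $ i $ j) field_differentiable at s within S"
    for X :: "complex \<Rightarrow> complex ^ 'n ^ 'n" and S
  proof -
    have "(\<lambda>s. \<Prod>i\<in>I. X s $ i $ p i) field_differentiable at s within S" if "finite I" for I p
      using that by (induction I) (auto intro!: derivative_intros \<open>\<And>i j. (\<lambda>s. X s $ i $ j) field_differentiable at s within S\<close>)
    then show ?thesis
      unfolding det_def by (intro field_differentiable_sum field_differentiable_mult) (auto intro: derivative_intros)
  qed
  have ent: "(\<lambda>s. ?M s $ i $ j) field_differentiable at s within S" for i j S
    by (cases "i = j") (auto simp: transpose_def mat_def intro!: derivative_intros)
  have "(\<lambda>s. ?N s $ i $ j) field_differentiable at s within S" for i j S
    using ent[of i j] by (cases "j = k") simp_all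
  then have "(\<lambda>s. det (?N s)) field_differentiable at s within {s. 0 \<le> Re s}"
    by (rule fd)
  moreover have "(\<lambda>s. det (?M s)) field_differentiable at s within {s. 0 \<le> Re s}"
    by (rule fd) (rule ent)
  ultimately have "(\<lambda>s. det (?N s) / det (?M s)) field_differentiable at s within {s. 0 \<le> Re s}"
    by (rule field_differentiable_divide) (rule d[OF s])
  then show ?thesis
    by (rule field_differentiable_transform_within[OF zero_less_one, rotated 2])
       (use s eq in auto)
qed

text \<open>The identity \<open>s u = u A + c\<close> reduces the claim to \<open>u\<close> tending
  to 0. The same identity gives \<open>(|s| - K) |u| \<le> |c|\<close>, where \<open>K\<close>
  bounds multiplication by \<open>A\<close>.\<close>

lemma resolvent_row_tendsto:
  fixes A :: "real ^ 'n ^ 'n"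
  assumes A: "hurwitz A"
  shows "((\<lambda>s. s *s resolvent_row A c s) \<longlongrightarrow> cvec c) (inf at_infinity (principal {s. 0 \<le> Re s}))"
    (is "(_ \<longlongrightarrow> _) ?F")
proof -
  have lin: "linear (\<lambda>u. u v* cmat A)"
    by (rule linearI) (simp_all add: vec_eq_iff vector_matrix_mult_def sum.distrib algebra_simps scaleR_sum_right)
  obtain K where K: "K > 0" "\<And>u. norm (u v* cmat A) \<le> norm u * K"
    using bounded_linear.pos_bounded[OF linear_conv_bounded_linear[THEN iffD1, OF lin]] by blast
  have sc: "norm (s *s v) = norm s * norm v" for s and v :: "complex ^ 'n"
    by (simp add: norm_vec_def norm_mult L2_set_right_distrib)
  \<comment> \<open>From \<open>K + 1\<close> on, the divisor \<open>|s| - K\<close> is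
    positive.\<close>
  have ev: "\<forall>\<^sub>F s in ?F. K + 1 \<le> norm s \<and> 0 \<le> Re s"
    unfolding eventually_inf_principal eventually_at_infinity by auto
  have "((\<lambda>s::complex. norm (cvec c) / (norm s - K)) \<longlongrightarrow> 0) at_infinity"
  proof (rule tendsto_divide_0[OF tendsto_const])
    show "filterlim (\<lambda>s::complex. norm s - K) at_infinity at_infinity"
      by (rule filterlim_at_top_imp_at_infinity)
         (use filterlim_tendsto_add_at_top[OF tendsto_const filterlim_norm_at_top, of "- K"] in simp)
  qed
  then have z: "((\<lambda>s. norm (cvec c) / (norm s - K)) \<longlongrightarrow> 0) ?F"
    by (rule tendsto_mono[rotated]) simp
  have "(resolvent_row A c \<longlongrightarrow> 0) ?F"
  proof (rule Lim_null_comparison[OF eventually_mono[OF ev] z])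
    fix s assume s: "K + 1 \<le> norm s \<and> 0 \<le> Re s"
    let ?u = "resolvent_row A c s"
    have "s *s ?u = ?u v* cmat A + cvec c"
      using resolvent_row_mult_cmat[OF A, of s c] s by simp
    then have "norm s * norm ?u \<le> norm ?u * K + norm (cvec c)"
      using norm_triangle_ineq[of "?u v* cmat A" "cvec c"] K(2)[of ?u] sc[of s ?u] by simp
    then show "norm ?u \<le> norm (cvec c) / (norm s - K)"
      using s by (simp add: field_simps)
  qed
  then have "((\<lambda>s. resolvent_row A c s v* cmat A) \<longlongrightarrow> 0 v* cmat A) ?F"
    by (rule bounded_linear.tendsto[OF linear_conv_bounded_linear[THEN iffD1, OF lin]])
  then have "((\<lambda>s. resolvent_row A c s v* cmat A + cvec c) \<longlongrightarrow> 0 + cvec c) ?F"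
    by (intro tendsto_add) auto
  moreover have "\<forall>\<^sub>F s in ?F. resolvent_row A c s v* cmat A + cvec c = s *s resolvent_row A c s"
    using ev by eventually_elim (simp add: resolvent_row_mult_cmat[OF A])
  ultimately show ?thesis
    using Lim_transform_eventually by fastforce
qed

lemma resolvent_row_continuous:
  assumes "hurwitz A"
  shows "continuous_on {s. 0 \<le> Re s} (resolvent_row A c)"
  unfolding continuous_on_def
  using field_differentiable_imp_continuous_at[OF resolvent_row_differentiable[OF assms]]
  by (auto simp: continuous_within intro: vec_tendstoI)

lemma resolvent_row_continuous_axis:
  assumes "hurwitz A"
  shows "continuous_on S (\<lambda>w. resolvent_row A c (\<i> * complex_of_real w))"
  by (rule continuous_on_compose2[OF resolvent_row_continuous[OF assms]]) (auto intro!: continuous_intros)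

text \<open>The half plane limit applies to the complex scalar \<open>u(s) z\<close>, for which
  \<open>s u(s) z\<close> tends to \<open>c z\<close>. The inner product with the real vector
  \<open>z\<close> is the real part of this scalar.\<close>

lemma resolvent_row_integral:
  fixes A :: "real ^ 'n ^ 'n"
  assumes A: "hurwitz A"
  shows "((\<lambda>T. integral {-T..T} (\<lambda>w. resolvent_row A c (\<i> * complex_of_real w) \<bullet> cvec z)) \<longlongrightarrow> pi * (c \<bullet> z)) at_top"
proof -
  let ?u = "resolvent_row A c"
  let ?f = "\<lambda>s. \<Sum>k\<in>UNIV. ?u s $ k * of_real (z $ k)"
  have Re: "resolvent_row A c s \<bullet> cvec z = Re (?f s)" for s
    by (simp add: inner_vec_def inner_complex_def)
  have cont: "continuous_on {s. 0 \<le> Re s} ?f"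
    by (intro continuous_intros continuous_on_component resolvent_row_continuous[OF A])
  have diff: "?f field_differentiable at s" if "0 < Re s" for s
  proof -
    have "s \<in> interior {s. 0 \<le> Re s}"
      using that interior_halfspace_ge[of "1::complex" 0] by (simp add: inner_complex_def)
    then have "at s within {s. 0 \<le> Re s} = at s" by (rule at_within_interior)
    then have "(\<lambda>s. ?u s $ k) field_differentiable at s" for k
      using resolvent_row_differentiable[OF A, of s c k] that by simp
    then show ?thesis by (intro field_differentiable_sum field_differentiable_mult) auto
  qed
  have "((\<lambda>s. \<Sum>k\<in>UNIV. (s *s ?u s) $ k * of_real (z $ k)) \<longlongrightarrow> (\<Sum>k\<in>UNIV. cvec c $ k * of_real (z $ k)))
      (inf at_infinity (principal {s. 0 \<le> Re s}))"
    by (intro tendsto_intros resolvent_row_tendsto[OF A])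
  then have lim: "((\<lambda>s. s * ?f s) \<longlongrightarrow> of_real (c \<bullet> z)) (inf at_infinity (principal {s. 0 \<le> Re s}))"
    by (simp add: sum_distrib_left mult.assoc inner_vec_def)
  have int: "(\<lambda>w. ?f (\<i> * complex_of_real w)) integrable_on {-T..T}" for T :: real
    by (intro integrable_continuous_real continuous_on_compose2[OF cont]) (auto intro!: continuous_intros)
  have "((\<lambda>T. Re (integral {-T..T} (\<lambda>w. ?f (\<i> * complex_of_real w)))) \<longlongrightarrow> Re (of_real pi * of_real (c \<bullet> z))) at_top"
    by (intro tendsto_Re half_plane_integral_limit[OF cont diff lim])
  moreover have "Re (integral {-T..T} (\<lambda>w. ?f (\<i> * complex_of_real w))) = integral {-T..T} (\<lambda>w. Re (?f (\<i> * complex_of_real w)))" for T :: real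
    using integral_linear[OF int bounded_linear_Re] by (simp add: o_def)
  ultimately show ?thesis unfolding Re by simp
qed

section \<open>Lyapunov equations and Gramians\<close>

lemma uminus_matrix_vector_mult: "(- M) *v x = - (M *v (x :: 'a::ring_1 ^ 'n))"
  by (simp add: vec_eq_iff matrix_vector_mult_def sum_negf)

lemma
  fixes M N :: "'a::ring_1 ^ 'm ^ 'n"
  shows matrix_add_rdistrib: "(M + N) ** K = M ** K + N ** K"
    and matrix_diff_rdistrib: "(M - N) ** K = M ** K - N ** K"
    and matrix_diff_ldistrib: "L ** (M - N) = L ** M - L ** N"
  by (simp_all add: vec_eq_iff matrix_matrix_mult_def algebra_simps sum.distrib sum_subtractf)

lemma matrix_mult_nth: "(M ** N) $ i = M $ i v* N"
  by (simp add: vec_eq_iff matrix_matrix_mult_def vector_matrix_mult_def)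

lemma cmat_add: "cmat (M + N) = cmat M + cmat N" and cmat_uminus: "cmat (- M) = - cmat M"
  by (simp_all add: map_matrix_def vec_eq_iff)

lemma cmat_transpose: "cmat (transpose M) = transpose (cmat M)"
  by (simp add: map_matrix_def transpose_def vec_eq_iff)

text \<open>On the imaginary axis multiplication by \<open>s\<close> is skew for the real inner
  product. After substituting \<open>u A = s u - c\<close> the two terms containing \<open>s\<close>
  cancel, and the rest is linear in the resolvent rows.\<close>

lemma resolvent_row_lyapunov:
  fixes A X :: "real ^ 'n ^ 'n" and w :: real
  assumes A: "hurwitz A"
  defines "s \<equiv> \<i> * complex_of_real w"
  shows "resolvent_row A c s \<bullet> (cmat (- (A ** X + X ** transpose A)) *v resolvent_row A d s)
    = resolvent_row A d s \<bullet> cvec (c v* X) + resolvent_row A c s \<bullet> cvec (X *v d)"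
proof -
  let ?u = "resolvent_row A c s" and ?v = "resolvent_row A d s"
  have s: "0 \<le> Re s" by (simp add: s_def)
  note eq = resolvent_row_mult_cmat[OF A s]
  have skew: "(s *s x) \<bullet> y = - (x \<bullet> (s *s y))" for x y :: "complex ^ 'n"
    by (simp add: inner_vec_def inner_complex_def s_def sum_negf[symmetric] algebra_simps)
  have "?u \<bullet> (cmat (A ** X + X ** transpose A) *v ?v)
      = (?u v* cmat A) \<bullet> (cmat X *v ?v) + ?u \<bullet> (cmat X *v (?v v* cmat A))"
    by (simp add: cmat_add cmat_mult cmat_transpose matrix_vector_mult_add_rdistrib inner_add_right
        inner_cmat flip: matrix_vector_mul_assoc)
  also have "\<dots> = - (cvec c \<bullet> (cmat X *v ?v) + ?u \<bullet> (cmat X *v cvec d))"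
    unfolding eq by (simp add: inner_diff_left inner_diff_right matrix_vector_mult_diff_distrib
        skew vector_scalar_commute)
  also have "\<dots> = - (?v \<bullet> cvec (c v* X) + ?u \<bullet> cvec (X *v d))"
    by (simp add: cvec_mult_cmat cmat_mult_cvec inner_commute flip: inner_cmat)
  finally show ?thesis
    by (simp only: cmat_uminus uminus_matrix_vector_mult inner_minus_right minus_minus)
qed

text \<open>Both linear terms contribute \<open>pi\<close> times the same number
  \<open>c X d\<close>. Two different rows are allowed so that uniqueness can read off the whole
  bilinear form of \<open>X\<close>.\<close>

lemma lyapunov_integral:
  fixes A X :: "real ^ 'n ^ 'n"
  assumes A: "hurwitz A" and W: "A ** X + X ** transpose A = - W"
  shows "((\<lambda>T. integral {-T..T} (\<lambda>w. resolvent_row A c (\<i> * complex_of_real w)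
      \<bullet> (cmat W *v resolvent_row A d (\<i> * complex_of_real w)))) \<longlongrightarrow> 2 * pi * (c \<bullet> (X *v d))) at_top"
proof -
  have int: "(\<lambda>w. resolvent_row A a (\<i> * complex_of_real w) \<bullet> z) integrable_on {-T..T}" for T a z
    by (intro integrable_continuous_real continuous_intros resolvent_row_continuous_axis[OF A])
  have W': "W = - (A ** X + X ** transpose A)" using W by simp
  have "((\<lambda>T. integral {-T..T} (\<lambda>w. resolvent_row A d (\<i> * complex_of_real w) \<bullet> cvec (c v* X))
      + integral {-T..T} (\<lambda>w. resolvent_row A c (\<i> * complex_of_real w) \<bullet> cvec (X *v d)))
      \<longlongrightarrow> pi * (d \<bullet> (c v* X)) + pi * (c \<bullet> (X *v d))) at_top"
    by (intro tendsto_add resolvent_row_integral[OF A])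
  moreover have "d \<bullet> (c v* X) = c \<bullet> (X *v d)"
    by (simp add: dot_lmul_matrix inner_commute[of d])
  ultimately show ?thesis
    unfolding W' resolvent_row_lyapunov[OF A] by (simp add: integral_add[OF int int] mult.assoc)
qed

text \<open>The difference solves the equation with right-hand side 0, so its integral
  representation vanishes for every pair of rows.\<close>

lemma lyapunov_unique:
  fixes A X Y :: "real ^ 'n ^ 'n"
  assumes A: "hurwitz A" and eq: "A ** X + X ** transpose A = A ** Y + Y ** transpose A"
  shows "X = Y"
proof -
  have e: "A ** (X - Y) + (X - Y) ** transpose A = - 0"
    using eq by (simp add: matrix_diff_ldistrib matrix_diff_rdistrib algebra_simps)
  have "c \<bullet> ((X - Y) *v d) = 0" for c d
  proof -
    have "cmat 0 = (0 :: complex ^ 'n ^ 'n)"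
      by (simp add: map_matrix_def vec_eq_iff)
    then have "((\<lambda>T::real. 0::real) \<longlongrightarrow> 2 * pi * (c \<bullet> ((X - Y) *v d))) at_top"
      using lyapunov_integral[OF A e, of c d] by simp
    then show ?thesis by (simp add: tendsto_const_iff)
  qed
  then have "(X - Y) *v d = 0" for d by (metis inner_eq_zero_iff)
  then have "X *v d = Y *v d" for d by (simp add: matrix_vector_mult_diff_rdistrib)
  then show ?thesis by (simp add: matrix_eq)
qed

text \<open>Uniqueness says that the Lyapunov operator is injective; on the finite-dimensional space
  of matrices it is then surjective.\<close>

lemma lyapunov_exists:
  fixes A W :: "real ^ 'n ^ 'n"
  assumes A: "hurwitz A"
  obtains X where "A ** X + X ** transpose A = - W"
proof -
  let ?L = "\<lambda>X. A ** X + X ** transpose A"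
  have "linear ?L"
    by (rule linearI) (simp_all add: matrix_add_ldistrib matrix_add_rdistrib algebra_simps
        matrix_scalar_ac scalar_matrix_assoc scaleR_right_distrib)
  moreover have "inj ?L" using lyapunov_unique[OF A] by (auto intro: injI)
  ultimately have "surj ?L" by (rule linear_inj_imp_surj)
  then obtain X where "- W = ?L X" by (rule surjE)
  then show thesis by (intro that) simp
qed

section \<open>Symmetry and positivity of Lyapunov solutions\<close>

lemma transpose_add: "transpose (M + N) = transpose M + transpose N"
  and transpose_uminus: "transpose (- M) = - transpose (M :: 'a::ab_group_add ^ 'n ^ 'm)"
  by (simp_all add: transpose_def vec_eq_iff)

text \<open>The transpose of a solution solves the same equation, so uniqueness applies.\<close>

lemma lyapunov_symmetric:
  fixes A X W :: "real ^ 'n ^ 'n"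
  assumes A: "hurwitz A" and X: "A ** X + X ** transpose A = - W" and W: "transpose W = W"
  shows "transpose X = X"
proof (rule lyapunov_unique[OF A])
  have "transpose (A ** X + X ** transpose A) = A ** X + X ** transpose A"
    using W by (simp add: X transpose_uminus)
  then show "A ** transpose X + transpose X ** transpose A = A ** X + X ** transpose A"
    by (simp add: transpose_add matrix_transpose_mul add.commute)
qed

text \<open>A real matrix does not mix real and imaginary parts, so nonnegativity on real vectors
  carries over to resolvent rows.\<close>

lemma inner_cmat_parts:
  "u \<bullet> (cmat W *v u) = (\<chi> i. Re (u $ i)) \<bullet> (W *v (\<chi> i. Re (u $ i))) + (\<chi> i. Im (u $ i)) \<bullet> (W *v (\<chi> i. Im (u $ i)))"
  by (simp add: inner_vec_def inner_complex_def matrix_vector_mult_def sum.distrib)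

text \<open>With two equal rows the integrand is a nonnegative form. Applied to differences of
  matrices this is the comparison principle behind \<open>Q \<ge> X\<close> and
  \<open>Y \<ge> d I\<close>.\<close>

lemma lyapunov_nonneg:
  fixes A X W :: "real ^ 'n ^ 'n"
  assumes A: "hurwitz A" and X: "A ** X + X ** transpose A = - W" and W: "\<And>x. 0 \<le> x \<bullet> (W *v x)"
  shows "0 \<le> c \<bullet> (X *v c)"
proof -
  have cont: "continuous_on S (\<lambda>x. W *v f x)" if "continuous_on S f" for S and f :: "real \<Rightarrow> real ^ 'n"
    by (rule bounded_linear.continuous_on[OF matrix_vector_mul_bounded_linear that])
  have "0 \<le> 2 * pi * (c \<bullet> (X *v c))"
    by (rule tendsto_lowerbound[OF lyapunov_integral[OF A X, of c c] always_eventually])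
       (auto intro!: Henstock_Kurzweil_Integration.integral_nonneg integrable_continuous_real continuous_intros cont
          resolvent_row_continuous_axis[OF A] simp: inner_cmat_parts W)
  then show ?thesis using pi_gt_zero by (simp add: zero_le_mult_iff)
qed

text \<open>On the axis the squared moduli in row \<open>i\<close> add up to the form of
  \<open>B B^T\<close> at \<open>u\<close>. Its integral is \<open>2 pi c X c^T\<close>, and the
  factor cancels against the normalization in \<open>h2_norm\<close>.\<close>

lemma gramian_h2_norm:
  fixes A X :: "real ^ 'n ^ 'n" and B :: "real ^ 'm ^ 'n" and C :: "real ^ 'n ^ 'p"
  assumes A: "hurwitz A" and X: "A ** X + X ** transpose A = - (B ** transpose B)"
  shows "(\<Sum>j\<in>UNIV. (h2_norm (\<lambda>s. transfer_matrix A B C s $ i $ j))\<^sup>2) = row i C \<bullet> (X *v row i C)"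
proof -
  define u where "u = (\<lambda>w. resolvent_row A (row i C) (\<i> * complex_of_real w))"
  define g where "g = (\<lambda>j w. (u w v* cmat B) $ j)"
  have tm: "transfer_matrix A B C (\<i> * complex_of_real w) $ i $ j = g j w" for w j
  proof -
    have "cmat C $ i = cvec (row i C)"
      by (simp add: vec_eq_iff row_def)
    then show ?thesis
      by (simp add: transfer_matrix_def g_def u_def resolvent_row_def matrix_mult_nth)
  qed
  have cont_u: "continuous_on UNIV u"
    unfolding u_def by (rule resolvent_row_continuous_axis[OF A])
  have cont_g: "continuous_on UNIV (g j)" for j
    unfolding g_def vector_matrix_mult_def by (simp, intro continuous_intros continuous_on_component cont_u)
  define h where "h = (\<lambda>w. \<Sum>j\<in>UNIV. (norm (g j w))\<^sup>2)"
  have cont_h: "continuous_on UNIV h"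
    unfolding h_def by (intro continuous_intros cont_g)
  have h: "h w = u w \<bullet> (cmat (B ** transpose B) *v u w)" for w
  proof -
    have "h w = (u w v* cmat B) \<bullet> (u w v* cmat B)"
      by (simp add: h_def g_def inner_vec_def power2_norm_eq_inner)
    also have "\<dots> = u w \<bullet> (cmat (B ** transpose B) *v u w)"
      by (simp add: inner_cmat cmat_mult cmat_transpose flip: matrix_vector_mul_assoc)
    finally show ?thesis .
  qed
  have "((\<lambda>T. integral {-T..T} h) \<longlongrightarrow> 2 * pi * (row i C \<bullet> (X *v row i C))) at_top"
    using lyapunov_integral[OF A X, of "row i C" "row i C"] unfolding h u_def by simp
  note lim = has_bochner_integral_symmetric_limit[OF cont_h _ this]
  have int_h: "integrable lborel h" and h_eq: "integral\<^sup>L lborel h = 2 * pi * (row i C \<bullet> (X *v row i C))"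
    by (rule lim; simp add: h_def sum_nonneg)+
  \<comment> \<open>Each entry is dominated by the integrable row sum \<open>h\<close>. This is
    needed to exchange sum and integral, because a nonintegrable function has integral 0 by
    convention.\<close>
  have int_g: "integrable lborel (\<lambda>w. (norm (g j w))\<^sup>2)" for j
  proof (rule Bochner_Integration.integrable_bound[OF int_h])
    show "(\<lambda>w. (norm (g j w))\<^sup>2) \<in> borel_measurable lborel"
      using borel_measurable_continuous_onI[OF cont_g[of j]] by simp
    show "AE w in lborel. norm ((norm (g j w))\<^sup>2) \<le> norm (h w)"
    proof (intro always_eventually allI)
      fix w
      have "(norm (g j w))\<^sup>2 \<le> h w"
        unfolding h_def by (rule member_le_sum) auto
      then show "norm ((norm (g j w))\<^sup>2) \<le> norm (h w)" by simp
    qed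
  qed
  have "(h2_norm (\<lambda>s. transfer_matrix A B C s $ i $ j))\<^sup>2 = 1 / (2 * pi) * (LINT w|lborel. (norm (g j w))\<^sup>2)" for j
    unfolding h2_norm_def tm by (rule real_sqrt_pow2) (simp add: integral_nonneg_AE)
  then have "(\<Sum>j\<in>UNIV. (h2_norm (\<lambda>s. transfer_matrix A B C s $ i $ j))\<^sup>2)
      = 1 / (2 * pi) * (\<Sum>j\<in>UNIV. LINT w|lborel. (norm (g j w))\<^sup>2)"
    by (simp only: sum_distrib_left)
  also have "(\<Sum>j\<in>UNIV. LINT w|lborel. (norm (g j w))\<^sup>2) = integral\<^sup>L lborel h"
    unfolding h_def by (rule Bochner_Integration.integral_sum[symmetric]) (rule int_g)
  finally show ?thesis by (simp add: h_eq)
qed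

section \<open>Definite matrices and Schur complements\<close>

lemma matrix_uminus_left: "(- M) ** N = - (M ** (N :: 'a::ring_1 ^ 'n ^ 'm))"
  and matrix_uminus_right: "M ** (- N) = - (M ** (N :: 'a::ring_1 ^ 'n ^ 'm))"
  by (simp_all add: vec_eq_iff matrix_matrix_mult_def sum_negf)

lemma neg_def_iff_pos_def: "neg_def M \<longleftrightarrow> pos_def (- M)"
proof -
  have "transpose M = M \<longleftrightarrow> transpose (- M) = - M" by (simp add: transpose_uminus)
  then show ?thesis by (simp add: neg_def_def pos_def_def uminus_matrix_vector_mult)
qed

lemma pos_def_sym: "pos_def M \<Longrightarrow> transpose M = M"
  by (simp add: pos_def_def)

lemma pos_def_pos: "pos_def M \<Longrightarrow> x \<noteq> 0 \<Longrightarrow> 0 < x \<bullet> (M *v x)"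
  by (simp add: pos_def_def)

lemma pos_def_nonneg: "pos_def M \<Longrightarrow> 0 \<le> x \<bullet> (M *v x)"
  by (cases "x = 0") (auto dest: pos_def_pos less_imp_le)

lemma pos_def_add_nonneg:
  assumes "pos_def M" "transpose N = N" "\<And>x. 0 \<le> x \<bullet> (N *v x)"
  shows "pos_def (M + N)"
  using assms by (auto simp: pos_def_def transpose_add matrix_vector_mult_add_rdistrib inner_add_right
      intro: add_pos_nonneg)

lemma pos_def_scaleR: "pos_def M \<Longrightarrow> 0 < e \<Longrightarrow> pos_def (e *\<^sub>R M)"
  by (auto simp: pos_def_def transpose_scalar simp flip: scaleR_matrix_vector_assoc)

lemma pos_def_mat_1: "pos_def (mat 1)"
  by (simp add: pos_def_def)

lemma pos_def_invertible:
  assumes "pos_def (M :: real ^ 'n ^ 'n)"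
  shows "invertible M"
proof -
  have "inj ((*v) M)"
  proof (rule injI)
    fix x y assume "M *v x = M *v y"
    then have "(x - y) \<bullet> (M *v (x - y)) = 0" by (simp add: matrix_vector_mult_diff_distrib)
    then show "x = y" using pos_def_pos[OF assms, of "x - y"] by fastforce
  qed
  then show ?thesis
    using matrix_left_invertible_injective invertible_left_inverse by blast
qed

lemma transpose_matrix_inv:
  fixes M :: "real ^ 'n ^ 'n"
  assumes "invertible M" "transpose M = M"
  shows "transpose (matrix_inv M) = matrix_inv M"
proof -
  have "transpose (matrix_inv M) ** M = mat 1"
    using arg_cong[OF matrix_inv_right[OF assms(1)], of transpose] assms(2)
    by (simp add: matrix_transpose_mul)
  then have "transpose (matrix_inv M) ** (M ** matrix_inv M) = matrix_inv M"
    by (simp add: matrix_mul_assoc)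
  then show ?thesis by (simp add: matrix_inv_right[OF assms(1)])
qed

lemma pos_def_congruence:
  fixes M T :: "real ^ 'n ^ 'n"
  assumes M: "pos_def M" and T: "invertible T"
  shows "pos_def (transpose T ** M ** T)"
  unfolding pos_def_def
proof (intro conjI allI impI)
  show "transpose (transpose T ** M ** T) = transpose T ** M ** T"
    by (simp add: matrix_transpose_mul pos_def_sym[OF M] matrix_mul_assoc)
  fix x :: "real ^ 'n" assume "x \<noteq> 0"
  then have "T *v x \<noteq> 0"
    using T by (metis invertible_def matrix_vector_mul_assoc matrix_vector_mul_lid matrix_vector_mult_0_right)
  then have "0 < (T *v x) \<bullet> (M *v (T *v x))" by (rule pos_def_pos[OF M])
  moreover have "x \<bullet> ((transpose T ** M ** T) *v x) = (M *v (T *v x)) \<bullet> (T *v x)"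
    by (simp add: inner_commute[of x] dot_lmul_matrix flip: matrix_vector_mul_assoc)
  ultimately show "0 < x \<bullet> ((transpose T ** M ** T) *v x)"
    by (simp add: inner_commute)
qed

lemma pos_def_congruence_iff:
  fixes M T :: "real ^ 'n ^ 'n"
  assumes T: "invertible T" and sym: "transpose T = T"
  shows "pos_def (T ** M ** T) \<longleftrightarrow> pos_def M"
proof
  let ?T = "matrix_inv T"
  have inv: "?T ** T = mat 1" "T ** ?T = mat 1" by (rule matrix_inv_left[OF T] matrix_inv_right[OF T])+
  assume "pos_def (T ** M ** T)"
  moreover have "invertible ?T" using inv by (auto simp: invertible_def)
  ultimately have "pos_def (transpose ?T ** (T ** M ** T) ** ?T)" by (rule pos_def_congruence)
  moreover have "transpose ?T ** (T ** M ** T) ** ?T = (?T ** T) ** M ** (T ** ?T)"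
    by (simp only: transpose_matrix_inv[OF T sym] matrix_mul_assoc)
  ultimately show "pos_def M" by (simp add: inv)
next
  assume "pos_def M"
  from pos_def_congruence[OF this T] show "pos_def (T ** M ** T)" by (simp only: sym)
qed

text \<open>The identity \<open>M = M M^-1 M\<close> exhibits \<open>M\<close> as a congruence
  transform of its inverse.\<close>

lemma pos_def_matrix_inv:
  fixes M :: "real ^ 'n ^ 'n"
  assumes M: "pos_def M"
  shows "pos_def (matrix_inv M)"
proof -
  note inv = pos_def_invertible[OF M] and sym = pos_def_sym[OF M]
  have "M ** matrix_inv M ** M = M" by (simp add: matrix_inv_right[OF inv])
  then show ?thesis using pos_def_congruence_iff[OF inv sym] M by metis
qed

lemma matrix_inv_involutive:
  fixes M :: "real ^ 'n ^ 'n"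
  assumes M: "invertible M"
  shows "matrix_inv (matrix_inv M) = M"
proof -
  have "invertible (matrix_inv M)"
    using matrix_inv_left[OF M] matrix_inv_right[OF M] by (auto simp: invertible_def)
  then have "M ** (matrix_inv M ** matrix_inv (matrix_inv M)) = M"
    by (simp add: matrix_inv_right)
  then show ?thesis by (simp add: matrix_mul_assoc matrix_inv_right[OF M])
qed

section \<open>Block vectors and block matrices\<close>

lemma sum_UNIV_sum_type:
  fixes f :: "'a::finite + 'b::finite \<Rightarrow> 'c::comm_monoid_add"
  shows "sum f UNIV = (\<Sum>a\<in>UNIV. f (Inl a)) + (\<Sum>b\<in>UNIV. f (Inr b))"
  by (simp add: sum.Plus flip: UNIV_Plus_UNIV)

definition join_vec :: "'a ^ 'm \<Rightarrow> 'a ^ 'n \<Rightarrow> 'a ^ ('m + 'n)" where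
  "join_vec a b = (\<chi> i. case i of Inl k \<Rightarrow> a $ k | Inr k \<Rightarrow> b $ k)"

lemma join_vec_cases:
  obtains a b where "x = join_vec a b"
proof
  show "x = join_vec (\<chi> k. x $ Inl k) (\<chi> k. x $ Inr k)"
    by (simp add: vec_eq_iff join_vec_def split: sum.split)
qed

lemma join_vec_eq_0_iff: "join_vec a b = 0 \<longleftrightarrow> a = 0 \<and> b = (0 :: 'a::zero ^ _)"
  unfolding join_vec_def vec_eq_iff split_sum_all vec_lambda_beta sum.case zero_index by blast

lemma inner_join_vec_block_mat:
  fixes M11 :: "real ^ 'm ^ 'm" and M22 :: "real ^ 'n ^ 'n"
  shows "join_vec a b \<bullet> (block_mat M11 M12 M21 M22 *v join_vec a b) =
    a \<bullet> (M11 *v a) + a \<bullet> (M12 *v b) + b \<bullet> (M21 *v a) + b \<bullet> (M22 *v b)"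
  by (simp add: inner_vec_def matrix_vector_mult_def sum_UNIV_sum_type join_vec_def block_mat_def
      sum.distrib distrib_left)

lemma transpose_block_mat:
  "transpose (block_mat M11 M12 M21 M22) = block_mat (transpose M11) (transpose M21) (transpose M12) (transpose M22)"
  by (simp add: transpose_def block_mat_def vec_eq_iff split: sum.split)

lemma block_mat_eq_iff:
  "block_mat M11 M12 M21 M22 = block_mat N11 N12 N21 N22 \<longleftrightarrow> M11 = N11 \<and> M12 = N12 \<and> M21 = N21 \<and> M22 = N22"
  unfolding block_mat_def vec_eq_iff split_sum_all vec_lambda_beta sum.case by blast

lemma uminus_block_mat: "- block_mat M11 M12 M21 M22 = block_mat (- M11) (- M12) (- M21) (- M22)"
  by (simp add: block_mat_def vec_eq_iff split: sum.split)

text \<open>Completing the square in \<open>b\<close> splits the form into the Schur complement at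
  \<open>a\<close> and the form of \<open>P\<close> at a shifted \<open>b\<close>. The pivot is the
  lower right block, as in both matrix inequalities.\<close>

lemma pos_def_schur:
  fixes K :: "real ^ 'm ^ 'm" and L :: "real ^ 'n ^ 'm" and P :: "real ^ 'n ^ 'n"
  assumes P: "pos_def P"
  shows "pos_def (block_mat K L (transpose L) P) \<longleftrightarrow> pos_def (K - L ** matrix_inv P ** transpose L)"
proof -
  let ?M = "block_mat K L (transpose L) P" and ?Q = "matrix_inv P"
  let ?S = "K - L ** ?Q ** transpose L"
  note sym = pos_def_sym[OF P] and inv = pos_def_invertible[OF P]
  have Q: "transpose ?Q = ?Q" by (rule transpose_matrix_inv[OF inv sym])
  have PQ: "P *v (?Q *v x) = x" "?Q *v (P *v x) = x" for x
    by (simp_all add: matrix_vector_mul_assoc matrix_inv_right[OF inv] matrix_inv_left[OF inv])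
  have symS: "transpose ?S = ?S \<longleftrightarrow> transpose K = K"
  proof -
    have "transpose (L ** ?Q ** transpose L) = L ** ?Q ** transpose L"
      by (simp add: matrix_transpose_mul Q matrix_mul_assoc)
    then have "transpose ?S = transpose K - L ** ?Q ** transpose L"
      by (simp add: transpose_def vec_eq_iff)
    then show ?thesis by simp
  qed
  have form: "join_vec a b \<bullet> (?M *v join_vec a b) = a \<bullet> (?S *v a)
      + (b + ?Q *v (transpose L *v a)) \<bullet> (P *v (b + ?Q *v (transpose L *v a)))" for a b
  proof -
    define y where "y = transpose L *v a"
    have 1: "a \<bullet> (L *v b) = y \<bullet> b" by (simp add: y_def dot_lmul_matrix)
    have 2: "a \<bullet> (?S *v a) = a \<bullet> (K *v a) - y \<bullet> (?Q *v y)"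
      by (simp add: y_def matrix_vector_mult_diff_rdistrib inner_diff_right dot_lmul_matrix
          flip: matrix_vector_mul_assoc)
    have 3: "(?Q *v y) \<bullet> (P *v b) = y \<bullet> b"
      using dot_lmul_matrix[of "?Q *v y" P b] transpose_matrix_vector[of P "?Q *v y"] sym PQ(1)[of y] by simp
    show ?thesis
      unfolding inner_join_vec_block_mat y_def[symmetric] 1 2
      by (simp add: matrix_vector_right_distrib inner_add_left inner_add_right PQ 3 3[unfolded inner_commute[of _ "P *v b"]] inner_commute[of b] inner_commute[of "?Q *v y" y])
  qed
  show ?thesis
  proof
    assume M: "pos_def ?M"
    have "transpose K = K"
      using pos_def_sym[OF M] by (simp add: transpose_block_mat block_mat_eq_iff)
    \<comment> \<open>This choice of the second block makes the completed square vanish.\<close>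
    moreover have "0 < a \<bullet> (?S *v a)" if "a \<noteq> 0" for a
      using pos_def_pos[OF M, of "join_vec a (- (?Q *v (transpose L *v a)))"] that
      unfolding form by (simp add: join_vec_eq_0_iff)
    ultimately show "pos_def ?S" by (simp add: pos_def_def symS del: transpose_matrix_vector)
  next
    assume S: "pos_def ?S"
    show "pos_def ?M"
      unfolding pos_def_def
    proof (intro conjI allI impI)
      show "transpose ?M = ?M"
        using pos_def_sym[OF S] symS sym by (simp add: transpose_block_mat)
      fix x :: "real ^ ('m + 'n)" assume x: "x \<noteq> 0"
      obtain a b where ab: "x = join_vec a b" by (rule join_vec_cases)
      show "0 < x \<bullet> (?M *v x)"
      proof (cases "a = 0")
        case True
        then have "b \<noteq> 0" using x ab by (simp add: join_vec_eq_0_iff)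
        then show ?thesis using pos_def_pos[OF P] True unfolding ab form by simp
      next
        case False
        then show ?thesis
          unfolding ab form by (intro add_pos_nonneg pos_def_pos[OF S] pos_def_nonneg[OF P])
      qed
    qed
  qed
qed

text \<open>Links the bounds on the diagonal of \<open>S\<close> to the row forms that express the
  squared \<open>H2\<close> norms.\<close>

lemma inner_row_mult: "(M ** X ** transpose M) $ l $ l = row l M \<bullet> (X *v row l (M :: real ^ 'n ^ 'm))"
proof -
  have "row l M \<bullet> (X *v row l M) = (\<Sum>j\<in>UNIV. M $ l $ j * (\<Sum>k\<in>UNIV. X $ j $ k * M $ l $ k))"
    by (simp add: inner_vec_def matrix_vector_mult_def row_def)
  also have "\<dots> = (M ** (X ** transpose M)) $ l $ l"
    by (simp add: matrix_matrix_mult_def transpose_def)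
  finally show ?thesis by (simp add: matrix_mul_assoc)
qed

section \<open>The matrix inequalities\<close>

lemma matrix_inv_mat_1: "matrix_inv (mat 1) = (mat 1 :: real ^ 'n ^ 'n)"
proof -
  have "invertible (mat 1 :: real ^ 'n ^ 'n)" by (rule pos_def_invertible[OF pos_def_mat_1])
  from matrix_inv_left[OF this] show ?thesis by simp
qed

text \<open>After negation the identity block is the Schur pivot. Congruence with
  \<open>Q = P^-1\<close> then turns \<open>A^T P + P A\<close> into \<open>Q A^T + A Q\<close> and
  strips \<open>P\<close> from \<open>P B \<theta>\<close>.\<close>

lemma lyapunov_lmi_iff:
  fixes A P :: "real ^ 'n ^ 'n" and B :: "real ^ 'm ^ 'n" and \<theta> :: "real ^ 'm ^ 'm"
  assumes P: "pos_def P" and \<theta>: "transpose \<theta> = \<theta>"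
  shows "neg_def (block_mat (transpose A ** P + P ** A) (P ** B ** \<theta>) (\<theta> ** transpose B ** P) (- mat 1))
    \<longleftrightarrow> neg_def (A ** matrix_inv P + matrix_inv P ** transpose A + (B ** \<theta>) ** transpose (B ** \<theta>))"
proof -
  let ?Q = "matrix_inv P" and ?L = "P ** B ** \<theta>" and ?K = "transpose A ** P + P ** A"
  note inv = pos_def_invertible[OF P] and sym = pos_def_sym[OF P]
  have tL: "\<theta> ** transpose B ** P = transpose ?L"
    by (simp add: matrix_transpose_mul \<theta> sym matrix_mul_assoc)
  have "neg_def (block_mat ?K ?L (transpose ?L) (- mat 1))
      \<longleftrightarrow> pos_def (block_mat (- ?K) (- ?L) (transpose (- ?L)) (mat 1))"
    by (simp add: neg_def_iff_pos_def uminus_block_mat transpose_uminus)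
  also have "\<dots> \<longleftrightarrow> pos_def (- (?K + ?L ** transpose ?L))"
    unfolding pos_def_schur[OF pos_def_mat_1]
    by (simp add: matrix_inv_mat_1 transpose_uminus matrix_uminus_left matrix_uminus_right)
  also have "\<dots> \<longleftrightarrow> pos_def (?Q ** (- (?K + ?L ** transpose ?L)) ** ?Q)"
    by (rule pos_def_congruence_iff[symmetric])
       (rule pos_def_invertible[OF pos_def_matrix_inv[OF P]] transpose_matrix_inv[OF inv sym])+
  also have "?Q ** (- (?K + ?L ** transpose ?L)) ** ?Q
      = - (A ** ?Q + ?Q ** transpose A + (B ** \<theta>) ** transpose (B ** \<theta>))"
  proof -
    have PQ: "X ** P ** ?Q = X" for X :: "real ^ 'n ^ 'k"
      by (simp add: matrix_inv_right[OF inv] flip: matrix_mul_assoc)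
    have "?Q ** (?K + ?L ** transpose ?L) ** ?Q
        = A ** ?Q + ?Q ** transpose A + (B ** \<theta>) ** transpose (B ** \<theta>)"
      by (simp add: matrix_add_ldistrib matrix_add_rdistrib
          matrix_transpose_mul sym \<theta> matrix_mul_assoc PQ matrix_inv_left[OF inv] add.commute)
    then show ?thesis by (simp only: matrix_uminus_left matrix_uminus_right)
  qed
  finally show ?thesis by (simp only: tL neg_def_iff_pos_def)
qed

text \<open>The Schur complement with pivot \<open>P\<close> is the congruence transform by
  \<open>\<theta>\<close> of the matrix on the right.\<close>

lemma output_lmi_iff:
  fixes P :: "real ^ 'n ^ 'n" and S \<theta> :: "real ^ 'm ^ 'm" and C :: "real ^ 'n ^ 'm"
  assumes P: "pos_def P" and \<theta>: "pos_def \<theta>"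
  shows "pos_def (block_mat (\<theta> ** S ** \<theta>) C (transpose C) P)
    \<longleftrightarrow> pos_def (S - (matrix_inv \<theta> ** C) ** matrix_inv P ** transpose (matrix_inv \<theta> ** C))"
proof -
  note inv = pos_def_invertible[OF \<theta>] and sym = pos_def_sym[OF \<theta>]
  have c: "X ** matrix_inv \<theta> ** \<theta> = X" for X :: "real ^ 'm ^ 'm"
    by (simp add: matrix_inv_left[OF inv] flip: matrix_mul_assoc)
  have "\<theta> ** S ** \<theta> - C ** matrix_inv P ** transpose C
      = \<theta> ** (S - (matrix_inv \<theta> ** C) ** matrix_inv P ** transpose (matrix_inv \<theta> ** C)) ** \<theta>"
    by (simp add: matrix_diff_ldistrib matrix_diff_rdistrib matrix_transpose_mul
        transpose_matrix_inv[OF inv sym] matrix_mul_assoc c matrix_inv_right[OF inv])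
  then show ?thesis
    using pos_def_schur[OF P, of "\<theta> ** S ** \<theta>" C] pos_def_congruence_iff[OF inv sym] by simp
qed

text \<open>Strictness comes from perturbation: for small \<open>d\<close> the matrix \<open>Y - d I\<close> still solves a Lyapunov
  equation with positive semidefinite right-hand side.\<close>

lemma lyapunov_mat_1_pos_def:
  fixes A Y :: "real ^ 'n ^ 'n"
  assumes A: "hurwitz A" and Y: "A ** Y + Y ** transpose A = - mat 1"
  shows "pos_def Y"
  unfolding pos_def_def
proof (intro conjI allI impI)
  show "transpose Y = Y" by (rule lyapunov_symmetric[OF A Y]) simp
  fix x :: "real ^ 'n" assume x: "x \<noteq> 0"
  obtain K where K: "0 < K" "\<And>x. norm (A *v x) \<le> norm x * K"
    using bounded_linear.pos_bounded[OF matrix_vector_mul_bounded_linear[of A]] by blast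
  \<comment> \<open>With \<open>2 d K = 1\<close> the form of \<open>d (A + A^T)\<close> is at most
    \<open>|x|^2\<close> in modulus, so \<open>?W\<close> is positive semidefinite.\<close>
  define d where "d = 1 / (2 * K)"
  have d: "0 < d" "2 * d * K = 1" using K by (simp_all add: d_def)
  let ?W = "mat 1 + d *\<^sub>R (A + transpose A)"
  have "A ** (Y - d *\<^sub>R mat 1) + (Y - d *\<^sub>R mat 1) ** transpose A
      = (A ** Y + Y ** transpose A) - d *\<^sub>R (A + transpose A)"
    by (simp add: matrix_diff_ldistrib matrix_diff_rdistrib matrix_scalar_ac scalar_matrix_assoc[symmetric]
        scaleR_right_distrib)
  then have eq: "A ** (Y - d *\<^sub>R mat 1) + (Y - d *\<^sub>R mat 1) ** transpose A = - ?W"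
    by (simp add: Y)
  have "0 \<le> x \<bullet> (?W *v x)" for x
  proof -
    have "\<bar>x \<bullet> (A *v x)\<bar> \<le> norm x * (norm x * K)"
      using Cauchy_Schwarz_ineq2[of x "A *v x"] mult_left_mono[OF K(2)[of x], of "norm x"] by simp
    then have "2 * d * \<bar>x \<bullet> (A *v x)\<bar> \<le> 2 * d * (norm x * (norm x * K))"
      using d by (intro mult_left_mono) auto
    also have "\<dots> = (2 * d * K) * (norm x * norm x)" by (simp only: mult_ac)
    also have "\<dots> = x \<bullet> x"
      by (simp only: d) (simp add: dot_square_norm power2_eq_square)
    finally have "2 * d * \<bar>x \<bullet> (A *v x)\<bar> \<le> x \<bullet> x" .
    moreover have "\<bar>2 * d * (x \<bullet> (A *v x))\<bar> = 2 * d * \<bar>x \<bullet> (A *v x)\<bar>"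
      using d by (simp add: abs_mult)
    moreover have "x \<bullet> (?W *v x) = x \<bullet> x + 2 * d * (x \<bullet> (A *v x))"
      by (simp add: matrix_vector_mult_add_rdistrib inner_add_right inner_commute[of x "x v* A"]
          dot_lmul_matrix algebra_simps flip: scaleR_matrix_vector_assoc)
    ultimately show ?thesis by linarith
  qed
  \<comment> \<open>Comparison gives \<open>Y \<ge> d I\<close>, which is the strict positivity
    sought.\<close>
  from lyapunov_nonneg[OF A eq this, of x] have "d * (x \<bullet> x) \<le> x \<bullet> (Y *v x)"
    by (simp add: matrix_vector_mult_diff_rdistrib inner_diff_right flip: scaleR_matrix_vector_assoc)
  moreover have "0 < d * (x \<bullet> x)" using d x by simp
  ultimately show "0 < x \<bullet> (Y *v x)" by linarith
qed

text \<open>Eliminates \<open>Q\<close> and \<open>S\<close>: every admissible \<open>Q\<close>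
  dominates the Gramian \<open>X\<close>, and the strict bounds leave room for a small perturbation
  of \<open>X\<close> that is admissible.\<close>

lemma lyapunov_inequality_feasible_iff:
  fixes A X :: "real ^ 'n ^ 'n" and B :: "real ^ 'm ^ 'n" and C :: "real ^ 'n ^ 'p"
  assumes A: "hurwitz A" and X: "A ** X + X ** transpose A = - (B ** transpose B)"
  shows "(\<exists>Q S. pos_def Q \<and> pos_def S \<and> (\<forall>l. S $ l $ l < \<gamma>)
      \<and> neg_def (A ** Q + Q ** transpose A + B ** transpose B)
      \<and> pos_def (S - C ** Q ** transpose C))
    \<longleftrightarrow> (\<forall>l. row l C \<bullet> (X *v row l C) < \<gamma>)" (is "?L \<longleftrightarrow> ?R")
proof
  assume ?L
  then obtain Q S where Q: "pos_def Q" and S: "\<And>l. S $ l $ l < \<gamma>"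
    and lyap: "neg_def (A ** Q + Q ** transpose A + B ** transpose B)"
    and out: "pos_def (S - C ** Q ** transpose C)" by blast
  let ?W = "- (A ** Q + Q ** transpose A + B ** transpose B)"
  \<comment> \<open>Subtracting the Gramian equation removes \<open>B B^T\<close>, so
    \<open>Q - X\<close> solves a Lyapunov equation with positive definite
    \<open>?W\<close>.\<close>
  have "A ** (Q - X) + (Q - X) ** transpose A = - ?W"
    using X by (simp add: matrix_diff_ldistrib matrix_diff_rdistrib algebra_simps)
  from lyapunov_nonneg[OF A this pos_def_nonneg[OF lyap[unfolded neg_def_iff_pos_def]]]
  have le: "row l C \<bullet> (X *v row l C) \<le> row l C \<bullet> (Q *v row l C)" for l
    by (simp add: matrix_vector_mult_diff_rdistrib inner_diff_right)
  have lt: "row l C \<bullet> (Q *v row l C) < S $ l $ l" for l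
  proof -
    \<comment> \<open>Testing with a unit vector extracts the diagonal entry.\<close>
    have "0 < axis l 1 \<bullet> ((S - C ** Q ** transpose C) *v axis l 1)"
      by (rule pos_def_pos[OF out]) (simp add: axis_eq_0_iff)
    then show ?thesis
      by (simp add: inner_axis' matrix_vector_mul_component inner_axis inner_row_mult)
  qed
  show ?R using le lt S by (meson le_less_trans less_trans)
next
  assume R: ?R
  have symB: "transpose (B ** transpose B) = B ** transpose B"
    by (simp add: matrix_transpose_mul)
  have symX: "transpose X = X" by (rule lyapunov_symmetric[OF A X symB])
  have nonnegX: "0 \<le> x \<bullet> (X *v x)" for x
  proof (rule lyapunov_nonneg[OF A X])
    show "0 \<le> x \<bullet> ((B ** transpose B) *v x)" for x
      by (simp add: dot_lmul_matrix[symmetric] flip: matrix_vector_mul_assoc)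
  qed
  obtain Y where Y: "A ** Y + Y ** transpose A = - mat 1"
    by (rule lyapunov_exists[OF A])
  have posY: "pos_def Y" by (rule lyapunov_mat_1_pos_def[OF A Y])
  \<comment> \<open>Adding \<open>e Y\<close> shifts the Lyapunov expression by \<open>- e I\<close>
    and makes \<open>Q\<close> definite where \<open>X\<close> may be only semidefinite; the summand
    \<open>e I\<close> in \<open>?S\<close> makes the output inequality strict.\<close>
  let ?Q = "\<lambda>e. X + e *\<^sub>R Y" and ?S = "\<lambda>e. e *\<^sub>R mat 1 + C ** (X + e *\<^sub>R Y) ** transpose C"
  \<comment> \<open>The left-hand side is the diagonal entry of \<open>?S e\<close>. It tends to the
    Gramian form, and since there are finitely many rows a single \<open>e\<close> serves them
    all.\<close>
  have "\<forall>\<^sub>F e in at_right 0. row l C \<bullet> (X *v row l C) + e * (row l C \<bullet> (Y *v row l C) + 1) < \<gamma>" for l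
  proof (rule order_tendstoD(2))
    show "((\<lambda>e. row l C \<bullet> (X *v row l C) + e * (row l C \<bullet> (Y *v row l C) + 1))
        \<longlongrightarrow> row l C \<bullet> (X *v row l C) + 0 * (row l C \<bullet> (Y *v row l C) + 1)) (at_right 0)"
      by (intro tendsto_intros)
  qed (use R in simp)
  then have "\<forall>\<^sub>F e in at_right 0. 0 < e \<and>
      (\<forall>l. row l C \<bullet> (X *v row l C) + e * (row l C \<bullet> (Y *v row l C) + 1) < \<gamma>)"
    by (intro eventually_conj eventually_at_right_less eventually_all_finite)
  then obtain e where e: "0 < e"
    and lt: "\<And>l. row l C \<bullet> (X *v row l C) + e * (row l C \<bullet> (Y *v row l C) + 1) < \<gamma>"
    using eventually_happens'[OF trivial_limit_at_right_real] by blast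
  have eq: "A ** ?Q e + ?Q e ** transpose A + B ** transpose B = - (e *\<^sub>R mat 1)"
  proof -
    have "A ** ?Q e + ?Q e ** transpose A = (A ** X + X ** transpose A) + e *\<^sub>R (A ** Y + Y ** transpose A)"
      by (simp add: matrix_add_ldistrib matrix_add_rdistrib matrix_scalar_ac scalar_matrix_assoc[symmetric]
          scaleR_right_distrib)
    then show ?thesis by (simp add: X Y)
  qed
  have e1: "pos_def (e *\<^sub>R mat 1 :: real ^ 'k ^ 'k)"
    by (rule pos_def_scaleR[OF pos_def_mat_1 e])
  have posQ: "pos_def (?Q e)"
    using pos_def_add_nonneg[OF pos_def_scaleR[OF posY e] symX nonnegX] by (simp add: add.commute)
  have "pos_def (?S e)"
  proof (rule pos_def_add_nonneg[OF e1])
    show "transpose (C ** ?Q e ** transpose C) = C ** ?Q e ** transpose C"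
      by (simp add: matrix_transpose_mul pos_def_sym[OF posQ] matrix_mul_assoc)
    show "0 \<le> x \<bullet> ((C ** ?Q e ** transpose C) *v x)" for x
      using pos_def_nonneg[OF posQ, of "transpose C *v x"]
      by (simp add: dot_lmul_matrix[symmetric] flip: matrix_vector_mul_assoc)
  qed
  moreover have "?S e $ l $ l < \<gamma>" for l
    using lt[of l] by (simp add: inner_row_mult mat_def matrix_vector_mult_add_rdistrib inner_add_right algebra_simps
        flip: scaleR_matrix_vector_assoc)
  moreover have "neg_def (A ** ?Q e + ?Q e ** transpose A + B ** transpose B)"
    unfolding eq neg_def_iff_pos_def using e1 by simp
  moreover have "pos_def (?S e - C ** ?Q e ** transpose C)"
    using e1 by simp
  ultimately show ?L using posQ by blast
qed

section \<open>The mean square norm as the end point of the feasible set\<close>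

lemma ms_norm_power2_less_iff:
  "(ms_norm G)\<^sup>2 < \<gamma> \<longleftrightarrow> (\<forall>i. (\<Sum>j\<in>UNIV. (h2_norm (\<lambda>s. G s $ i $ j))\<^sup>2) < \<gamma>)"
proof -
  define a where "a i = (\<Sum>j\<in>UNIV. (h2_norm (\<lambda>s. G s $ i $ j))\<^sup>2)" for i
  have a: "0 \<le> a i" for i by (simp add: a_def sum_nonneg)
  have M: "ms_norm G = Max (range (\<lambda>i. sqrt (a i)))" by (simp add: ms_norm_def a_def)
  \<comment> \<open>The maximum over finitely many rows is attained, so the squared norm is itself
    one of the row sums.\<close>
  have "ms_norm G \<in> range (\<lambda>i. sqrt (a i))" unfolding M by (rule Max_in) auto
  then obtain k where k: "ms_norm G = sqrt (a k)" by blast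
  have le: "a i \<le> a k" for i
  proof -
    have "sqrt (a i) \<le> ms_norm G" unfolding M by (rule Max_ge) auto
    then show ?thesis by (simp add: k)
  qed
  have "(ms_norm G)\<^sup>2 = a k" using a by (simp add: k)
  then show ?thesis unfolding a_def[symmetric] using le by (metis le_less_trans)
qed

text \<open>The feasible \<open>\<gamma>\<close> form an open ray, so the infimum is approached from
  above by \<open>a + e\<close> but not attained.\<close>

lemma INF_ereal_greaterThan: "(INF \<gamma> \<in> {a<..}. ereal \<gamma>) = ereal a"
proof (rule antisym)
  show "(INF \<gamma> \<in> {a<..}. ereal \<gamma>) \<le> ereal a"
  proof (rule ereal_le_epsilon2)
    fix e :: real assume "0 < e"
    then show "(INF \<gamma> \<in> {a<..}. ereal \<gamma>) \<le> ereal a + ereal e"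
      by (intro INF_lower2[of "a + e"]) auto
  qed
qed (rule INF_greatest, simp)

theorem lemma13:
  fixes Ap :: "real ^ 'n ^ 'n" and Bp :: "real ^ 'd ^ 'n" and Cp :: "real ^ 'n ^ 'q"
    and Ak :: "real ^ 'n ^ 'n" and Bk :: "real ^ 'q ^ 'n" and Ck :: "real ^ 'n ^ 'd"
    and \<Lambda>\<^sub>O :: "real ^ 'q ^ 'q" and \<Lambda>\<^sub>I :: "real ^ 'd ^ 'd"
    and A :: "real ^ ('n + 'n) ^ ('n + 'n)"
    and B :: "real ^ ('q + 'd) ^ ('n + 'n)"
    and C :: "real ^ ('n + 'n) ^ ('q + 'd)"
    and \<theta> :: "real ^ ('q + 'd) ^ ('q + 'd)"
  assumes "stabilizable Ap Bp" and "detectable Ap Cp"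
    and "diagonal \<Lambda>\<^sub>O" and "diagonal \<Lambda>\<^sub>I"
    and "A = block_mat Ap (Bp ** \<Lambda>\<^sub>I ** Ck) (Bk ** \<Lambda>\<^sub>O ** Cp) Ak"
    and "B = block_mat 0 Bp Bk 0"
    and "C = block_mat Cp 0 0 Ck"
    and "hurwitz A"
    and "diagonal \<theta>" and "pos_def \<theta>"
  shows "ereal ((ms_norm (\<lambda>s. cmat (matrix_inv \<theta>) ** transfer_matrix A B C s ** cmat \<theta>))\<^sup>2) =
    (INF \<gamma> \<in> {\<gamma> :: real. \<exists>(P :: real ^ ('n + 'n) ^ ('n + 'n)) (S :: real ^ ('q + 'd) ^ ('q + 'd)).
        pos_def P \<and> pos_def S \<and> (\<forall>l. S $ l $ l < \<gamma>) \<and>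
        neg_def (block_mat (transpose A ** P + P ** A) (P ** B ** \<theta>)
                           (\<theta> ** transpose B ** P) (- mat 1)) \<and>
        pos_def (block_mat (\<theta> ** S ** \<theta>) C (transpose C) P)}. ereal \<gamma>)"
proof -
  let ?B = "B ** \<theta>" and ?C = "matrix_inv \<theta> ** C"
  note A = \<open>hurwitz A\<close> and \<theta> = \<open>pos_def \<theta>\<close>
  obtain X where X: "A ** X + X ** transpose A = - (?B ** transpose ?B)"
    by (rule lyapunov_exists[OF A])
  let ?G = "\<lambda>s. cmat (matrix_inv \<theta>) ** transfer_matrix A B C s ** cmat \<theta>"
  let ?lmi = "\<lambda>P S. neg_def (block_mat (transpose A ** P + P ** A) (P ** B ** \<theta>)
                           (\<theta> ** transpose B ** P) (- mat 1)) \<and>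
        pos_def (block_mat (\<theta> ** S ** \<theta>) C (transpose C) P)"
  let ?lyap = "\<lambda>Q S. neg_def (A ** Q + Q ** transpose A + ?B ** transpose ?B) \<and>
        pos_def (S - ?C ** Q ** transpose ?C)"
  have lmi: "?lmi P S \<longleftrightarrow> ?lyap (matrix_inv P) S" if "pos_def P" for P S
    using lyapunov_lmi_iff[OF that pos_def_sym[OF \<theta>]] output_lmi_iff[OF that \<theta>] by simp
  \<comment> \<open>The scaling by \<open>\<theta>\<close> is absorbed into the input and output
    matrices, so the Gramian formula applies directly.\<close>
  have G: "?G = transfer_matrix A ?B ?C"
    by (simp add: fun_eq_iff transfer_matrix_def cmat_mult matrix_mul_assoc)
  have feasible: "(\<exists>P S. pos_def P \<and> pos_def S \<and> (\<forall>l. S $ l $ l < \<gamma>) \<and> ?lmi P S) \<longleftrightarrow> (ms_norm ?G)\<^sup>2 < \<gamma>" for \<gamma>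
  proof -
    \<comment> \<open>Inversion is an involution on positive definite matrices, so quantifying over
      \<open>P\<close> amounts to quantifying over \<open>Q = P^-1\<close>.\<close>
    have "(\<exists>P S. pos_def P \<and> pos_def S \<and> (\<forall>l. S $ l $ l < \<gamma>) \<and> ?lmi P S)
        \<longleftrightarrow> (\<exists>Q S. pos_def Q \<and> pos_def S \<and> (\<forall>l. S $ l $ l < \<gamma>) \<and> ?lyap Q S)" (is "?P \<longleftrightarrow> ?Q")
    proof
      assume ?P
      then obtain P S where "pos_def P" "pos_def S" "\<forall>l. S $ l $ l < \<gamma>" "?lmi P S" by blast
      then show ?Q using lmi pos_def_matrix_inv by blast
    next
      assume ?Q
      then obtain Q S where Q: "pos_def Q" and S: "pos_def S" "\<forall>l. S $ l $ l < \<gamma>" and "?lyap Q S" by blast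
      then have "?lyap (matrix_inv (matrix_inv Q)) S"
        by (simp add: matrix_inv_involutive pos_def_invertible)
      then have "?lmi (matrix_inv Q) S"
        using lmi[OF pos_def_matrix_inv[OF Q]] by blast
      then show ?P using pos_def_matrix_inv[OF Q] S by blast
    qed
    also have "\<dots> \<longleftrightarrow> (ms_norm ?G)\<^sup>2 < \<gamma>"
      unfolding lyapunov_inequality_feasible_iff[OF A X] ms_norm_power2_less_iff G gramian_h2_norm[OF A X] ..
    finally show ?thesis .
  qed
  show ?thesis
    unfolding feasible by (rule INF_ereal_greaterThan[unfolded greaterThan_def, symmetric])
qed

end
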